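(* Let $G$ be a connected $(\text{fork}^+, C_4, C_3)$-free graph without clique cutsets. If $G$ is not a complete graph, then $G$ is (isomorphic to a graph) in $\mathfrak{F}'$.
   Context: All graphs are finite and simple. $C_k$ is the cycle on $k$ vertices. A graph is $(H_1,H_2,\dots)$-free if it has no induced subgraph isomorphic to any $H_i$. A fork$^+$ is obtained from $K_{1,3}$ by subdividing one edge twice. A clique cutset of $G$ is a clique $K$ such that $G-K$ has more components than $G$. Let $v_1v_2v_3v_4v_5v_1$ be a 5-cycle. Define: $F_2'$ is this 5-cycle plus vertices $a_1,a_3$ with added edges $a_1v_1,a_3v_3,a_1a_3$; $F_3$ is the 5-cycle plus $a_1,a_3,a_4$ with added edges $a_iv_i$ $(i=1,3,4)$, $a_1a_3$, $a_1a_4$; $F_4$ is the 5-cycle plus $a_1,a_3,a_4,a_5$ with added edges $a_iv_i$ $(i=1,3,4,5)$, $a_1a_3$, $a_1a_4$, $a_3a_5$; $F_5$ is the Petersen graph. Let $\mathfrak{F}'=\{F_2',F_3,F_4,F_5\}\cup\{C_k : k\ge 5 \text{ an integer}\}$. *)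

theory Defs
  imports "Graph_Theory.Graph_Theory"
begin

text \<open>
  A finite simple graph is a \<^locale>\<open>pair_graph\<close>: a finite vertex set \<^const>\<open>pverts\<close> together with
  a symmetric irreflexive relation \<^const>\<open>parcs\<close>, so that each edge is present in both
  orientations. On such graphs the strongly connected components \<^const>\<open>pre_digraph.sccs\<close>
  are the connected components.
\<close>

definition H_free :: "'b pair_pre_digraph set \<Rightarrow> 'a pair_pre_digraph \<Rightarrow> bool" where
  "H_free \<H> G \<longleftrightarrow>
     (\<forall>H\<in>\<H>. \<not> (\<exists>K. induced_subgraph K (with_proj G) \<and> digraph_iso K (with_proj H)))"

definition clique :: "'a pair_pre_digraph \<Rightarrow> 'a set \<Rightarrow> bool" where
  "clique G K \<longleftrightarrow> K \<subseteq> pverts G \<and> (\<forall>u\<in>K. \<forall>v\<in>K. u \<noteq> v \<longrightarrow> (u, v) \<in> parcs G)"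

definition clique_cutset :: "'a pair_pre_digraph \<Rightarrow> 'a set \<Rightarrow> bool" where
  "clique_cutset G K \<longleftrightarrow> clique G K \<and>
     card (pre_digraph.sccs (with_proj G \<restriction> (pverts G - K))) > card (pre_digraph.sccs (with_proj G))"

definition extend :: "'a pair_pre_digraph \<Rightarrow> 'a set \<Rightarrow> 'a rel \<Rightarrow> 'a pair_pre_digraph" where
  "extend G W E = \<lparr> pverts = pverts G \<union> W, parcs = parcs G \<union> symcl E \<rparr>"

text \<open>Only meaningful for \<open>k \<ge> 3\<close>.\<close>

definition cycle_graph :: "nat \<Rightarrow> nat pair_pre_digraph" where
  "cycle_graph k =
     \<lparr> pverts = {1..k}, parcs = symcl ({(i, Suc i) | i. 1 \<le> i \<and> i < k} \<union> {(k, 1)}) \<rparr>"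

definition claw :: "nat pair_pre_digraph" where
  "claw = \<lparr> pverts = {0, 1, 2, 3}, parcs = symcl {(0, 1), (0, 2), (0, 3)} \<rparr>"

text \<open>The edge from 0 to 3 of the claw becomes the path 0, 4, 5, 3.\<close>

definition fork_plus :: "nat pair_pre_digraph" where
  "fork_plus = subdivide (subdivide claw (0, 3) 4) (4, 3) 5"

text \<open>In the next four graphs the vertex \<open>v\<^sub>i\<close> is the number \<open>i\<close> and \<open>a\<^sub>i\<close> is the number \<open>10 + i\<close>.\<close>

definition F2' :: "nat pair_pre_digraph" where
  "F2' = extend (cycle_graph 5) {11, 13} {(11, 1), (13, 3), (11, 13)}"

definition F3 :: "nat pair_pre_digraph" where
  "F3 = extend (cycle_graph 5) {11, 13, 14}
     {(11, 1), (13, 3), (14, 4), (11, 13), (11, 14)}"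

definition F4 :: "nat pair_pre_digraph" where
  "F4 = extend (cycle_graph 5) {11, 13, 14, 15}
     {(11, 1), (13, 3), (14, 4), (15, 5), (11, 13), (11, 14), (13, 15)}"

text \<open>The Petersen graph: outer 5-cycle \<open>v\<^sub>1 \<dots> v\<^sub>5\<close>, spokes, and inner pentagram on the \<open>a\<^sub>i\<close>.\<close>

definition F5 :: "nat pair_pre_digraph" where
  "F5 = extend (cycle_graph 5) {11, 12, 13, 14, 15}
     {(11, 1), (12, 2), (13, 3), (14, 4), (15, 5),
      (11, 13), (13, 15), (15, 12), (12, 14), (14, 11)}"

definition frakF' :: "nat pair_pre_digraph set" where
  "frakF' = {F2', F3, F4, F5} \<union> {cycle_graph k | k. k \<ge> 5}"

end

theory Submission
  imports Defs
begin

text \<open>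
  Excluding \<open>C\<^sub>3\<close> and \<open>C\<^sub>4\<close> means girth at least 5, and the absence of clique cutsets makes all
  degrees at least 2. The rest of the local structure comes from one reading of the excluded
  fork\<open>\<^sup>+\<close>. Let \<open>x, p, q, r\<close> be a path and let \<open>y, z\<close> be two further neighbours of \<open>x\<close>. By the girth
  condition the only possible chords in this configuration are \<open>r y\<close> and \<open>r z\<close>, so one of them must
  be present (\<open>path_end_adjacent\<close>), and not both, as that would close a 4-cycle. Two consequences:

  \<^item> If \<open>x\<close> had three neighbours besides \<open>p\<close>, then \<open>r\<close> would be adjacent to two of them; so all
    degrees are at most 3 (\<open>degree_le_3\<close>).
  \<^item> The end of a path of length 3 that starts in a vertex of degree 3 is at distance at most 2 from
    that vertex, so a vertex of degree 3 reaches the whole graph in two steps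
    (\<open>within_distance_2\<close>).

  If there is no vertex of degree 3, the connected graph is 2-regular, hence a cycle, of length at
  least 5. Otherwise let \<open>c\<close> have degree 3. The graph consists of \<open>c\<close>, its three neighbours, and
  the one or two further neighbours of each of these, which form three disjoint groups. Between two
  groups the edges form a matching, since there are no 4-cycles; and if a neighbour \<open>p\<close> of \<open>c\<close> has
  degree 3, the distance bound for \<open>p\<close> makes every vertex of the other groups matched into the group
  of \<open>p\<close> (\<open>partner\<close>). This leaves very little choice: if 0, 1, 2 or 3 neighbours of \<open>c\<close> have degree
  3, then the graph is \<open>F2'\<close>, \<open>F3\<close>, \<open>F4\<close> or the Petersen graph \<open>F5\<close>, respectively. The one
  exceptional configuration, two 5-cycles glued along an edge, has that edge as a clique cutset.
\<close>

section \<open>Neighbourhoods, isomorphisms and induced copies\<close>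

definition nbrs :: "'a pair_pre_digraph \<Rightarrow> 'a \<Rightarrow> 'a set" where
  "nbrs G v = {w. (v, w) \<in> parcs G}"

lemma digraph_iso_nbrsI:
  assumes G: "pair_wf_digraph G" and H: "pair_wf_digraph H"
    and inj: "inj_on f (pverts H)"
    and verts: "pverts G = f ` pverts H"
    and nbrs: "\<And>u. u \<in> pverts H \<Longrightarrow> nbrs G (f u) = f ` nbrs H u"
  shows "digraph_iso (with_proj G) (with_proj H)"
proof -
  interpret G: pair_wf_digraph G by (rule G)
  interpret H: pair_wf_digraph H by (rule H)
  let ?h = "\<lparr>iso_verts = f, iso_arcs = map_prod f f, iso_head = snd, iso_tail = fst\<rparr>"
  have "inj_on (map_prod f f) (parcs H)"
    by (rule inj_on_subset[OF map_prod_inj_on[OF inj inj]]) (auto dest: H.wellformed')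
  then have "pre_digraph.digraph_isomorphism (with_proj H) ?h"
    using inj H.wf_digraph by (auto simp: pre_digraph.digraph_isomorphism_def)
  moreover have "parcs G = map_prod f f ` parcs H"
  proof (intro set_eqI iffI)
    fix e assume e: "e \<in> parcs G"
    obtain x y where xy: "e = (x, y)" by (cases e)
    with e have "x \<in> pverts G" by (auto dest: G.wellformed')
    then obtain u where u: "u \<in> pverts H" "x = f u" using verts by auto
    have "y \<in> f ` nbrs H u" using e xy u nbrs by (auto simp: nbrs_def)
    then show "e \<in> map_prod f f ` parcs H" using xy u by (auto simp: nbrs_def)
  next
    fix e assume "e \<in> map_prod f f ` parcs H"
    then obtain u v where uv: "(u, v) \<in> parcs H" "e = (f u, f v)" by auto
    then have "f v \<in> nbrs G (f u)" using nbrs[of u] by (auto simp: nbrs_def dest: H.wellformed')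
    then show "e \<in> parcs G" using uv by (simp add: nbrs_def)
  qed
  then have "with_proj G = app_iso ?h (with_proj H)"
    using verts by (auto simp: app_iso_def with_proj_def)
  ultimately have "digraph_iso (with_proj H) (with_proj G)"
    unfolding digraph_iso_def by blast
  then show ?thesis by (rule digraph_iso_swap[OF H.wf_digraph])
qed

text \<open>
  For a concrete graph the bijection is given by the list \<open>us\<close> of its vertices, and all hypotheses
  become finite checks.
\<close>

lemma digraph_iso_tableI:
  assumes wf: "pair_wf_digraph G" "pair_wf_digraph H"
    and us: "pverts H = set us" and dist: "distinct (map f us)"
    and verts: "pverts G = set (map f us)"
    and nbrs: "list_all (\<lambda>u. nbrs G (f u) = f ` nbrs H u) us"
  shows "digraph_iso (with_proj G) (with_proj H)"
proof (rule digraph_iso_nbrsI[OF wf])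
  show "inj_on f (pverts H)" using dist by (simp add: us distinct_map)
  show "pverts G = f ` pverts H" using verts by (simp add: us)
  show "nbrs G (f u) = f ` nbrs H u" if "u \<in> pverts H" for u
    using that nbrs by (auto simp: us list_all_iff)
qed

text \<open>
  The forbidden configurations are produced as injections from the forbidden graph into \<open>G\<close>; the
  induced subgraph meant by \<open>H_free\<close> is the one on the image.
\<close>

lemma H_free_no_induced_copy:
  assumes G: "pair_wf_digraph G" and H: "pair_wf_digraph H"
    and free: "H_free \<H> G" "H \<in> \<H>"
    and inj: "inj_on f (pverts H)" and verts: "f ` pverts H \<subseteq> pverts G"
    and arcs: "\<And>u v. u \<in> pverts H \<Longrightarrow> v \<in> pverts H \<Longrightarrow> (f u, f v) \<in> parcs G \<longleftrightarrow> (u, v) \<in> parcs H"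
  shows False
proof -
  interpret G: pair_wf_digraph G by (rule G)
  interpret H: pair_wf_digraph H by (rule H)
  let ?K = "\<lparr>pverts = f ` pverts H, parcs = {e \<in> parcs G. fst e \<in> f ` pverts H \<and> snd e \<in> f ` pverts H}\<rparr>"
  have K: "with_proj ?K = with_proj G \<restriction> (f ` pverts H)"
    by (simp add: with_proj_def induce_subgraph_def)
  have wf: "pair_wf_digraph ?K" by unfold_locales auto
  have "induced_subgraph (with_proj ?K) (with_proj G)"
    unfolding K using verts by (intro G.induced_induce) simp
  moreover have "digraph_iso (with_proj ?K) (with_proj H)"
  proof (rule digraph_iso_nbrsI[OF wf H inj])
    fix u assume u: "u \<in> pverts H"
    show "nbrs ?K (f u) = f ` nbrs H u"
    proof (intro set_eqI iffI)
      fix y assume "y \<in> nbrs ?K (f u)"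
      then show "y \<in> f ` nbrs H u" using u arcs by (auto simp: nbrs_def)
    next
      fix y assume "y \<in> f ` nbrs H u"
      then obtain v where v: "y = f v" "(u, v) \<in> parcs H" by (auto simp: nbrs_def)
      then have "v \<in> pverts H" by (auto dest: H.wellformed')
      then show "y \<in> nbrs ?K (f u)" using u v arcs by (auto simp: nbrs_def)
    qed
  qed simp
  ultimately show False using free unfolding H_free_def by blast
qed

lemma pair_wf_digraphI:
  "(\<And>u v. (u, v) \<in> parcs H \<Longrightarrow> u \<in> pverts H \<and> v \<in> pverts H) \<Longrightarrow> pair_wf_digraph H"
  by unfold_locales auto

lemma cycle_graph_arc_iff:
  "(i, j) \<in> parcs (cycle_graph k) \<longleftrightarrow>
     (1 \<le> i \<and> i < k \<and> j = Suc i) \<or> (1 \<le> j \<and> j < k \<and> i = Suc j) \<or> (i = k \<and> j = 1) \<or> (i = 1 \<and> j = k)"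
  unfolding cycle_graph_def symcl_def by auto

lemma cycle_graph_verts: "pverts (cycle_graph k) = {1..k}"
  by (simp add: cycle_graph_def)

lemma pair_wf_cycle_graph: "k \<ge> 1 \<Longrightarrow> pair_wf_digraph (cycle_graph k)"
  by (rule pair_wf_digraphI) (auto simp: cycle_graph_arc_iff cycle_graph_verts)

lemma fork_plus_verts: "pverts fork_plus = {0, 1, 2, 3, 4, 5}"
  by (auto simp: fork_plus_def claw_def subdivide.simps)

lemma fork_plus_arcs:
  "parcs fork_plus = {(0,1), (1,0), (0,2), (2,0), (0,4), (4,0), (4,5), (5,4), (5,3), (3,5)}"
  by (auto simp: fork_plus_def claw_def subdivide.simps symcl_def)

lemma pair_wf_fork_plus: "pair_wf_digraph fork_plus"
  by (rule pair_wf_digraphI) (auto simp: fork_plus_arcs fork_plus_verts)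

lemma nbrs_extend: "nbrs (extend G W E) v = nbrs G v \<union> symcl E `` {v}"
  by (auto simp: nbrs_def extend_def)

lemma pverts_extend: "pverts (extend G W E) = pverts G \<union> W"
  by (simp add: extend_def)

text \<open>The simplifier turns the vertex \<open>1\<close> into \<open>Suc 0\<close>, so that form is listed as well.\<close>

lemma nbrs_cycle_graph_5:
  "nbrs (cycle_graph 5) 1 = {2, 5}" "nbrs (cycle_graph 5) (Suc 0) = {2, 5}"
  "nbrs (cycle_graph 5) 2 = {1, 3}" "nbrs (cycle_graph 5) 3 = {2, 4}"
  "nbrs (cycle_graph 5) 4 = {3, 5}" "nbrs (cycle_graph 5) 5 = {1, 4}"
  "v > 5 \<Longrightarrow> nbrs (cycle_graph 5) v = {}"
  by (auto simp: nbrs_def cycle_graph_arc_iff)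

lemma verts_cycle_graph_5: "pverts (cycle_graph 5) = {1, 2, 3, 4, 5}"
  by (auto simp: cycle_graph_verts)

lemma symcl_Image:
  "symcl {} `` {v} = {}"
  "symcl (insert (a, b) E) `` {v} =
     (if v = a then {b} else {}) \<union> (if v = b then {a} else {}) \<union> symcl E `` {v}"
  by (auto simp: symcl_def)

lemma pair_wf_extend:
  assumes "pair_wf_digraph G" "E \<subseteq> (pverts G \<union> W) \<times> (pverts G \<union> W)"
  shows "pair_wf_digraph (extend G W E)"
proof -
  interpret pair_wf_digraph G by fact
  show ?thesis
    using assms(2) by (intro pair_wf_digraphI) (auto simp: extend_def symcl_def dest: wellformed')
qed

lemma pair_wf_F:
  "pair_wf_digraph F2'" "pair_wf_digraph F3" "pair_wf_digraph F4" "pair_wf_digraph F5"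
  unfolding F2'_def F3_def F4_def F5_def
  by (intro pair_wf_extend pair_wf_cycle_graph; simp add: verts_cycle_graph_5)+

lemmas F_simps = F2'_def F3_def F4_def F5_def nbrs_extend pverts_extend nbrs_cycle_graph_5
  verts_cycle_graph_5 symcl_Image

section \<open>Connected graphs\<close>

context pair_graph
begin

lemma nbrs_sym: "v \<in> nbrs G u \<longleftrightarrow> u \<in> nbrs G v"
  by (auto simp: nbrs_def intro: arcs_symmetric)

lemma nbrs_irrefl: "u \<notin> nbrs G u"
  using no_loops' by (auto simp: nbrs_def)

lemma nbrs_verts: "v \<in> nbrs G u \<Longrightarrow> v \<in> pverts G"
  by (auto simp: nbrs_def dest: wellformed')

lemma finite_nbrs: "finite (nbrs G u)"
  by (rule finite_subset[OF _ pair_finite_verts]) (auto dest: nbrs_verts)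

lemma connected_closed_set:
  assumes conn: "Digraph_Component.connected (with_proj G)"
    and x: "x \<in> S" "x \<in> pverts G"
    and closed: "\<And>u. u \<in> S \<Longrightarrow> nbrs G u \<subseteq> S"
  shows "pverts G \<subseteq> S"
proof
  fix y assume "y \<in> pverts G"
  then have "(x, y) \<in> rtrancl_on (pverts G) ((parcs G)\<^sup>s)"
    using conn x by (auto simp: connected_conv)
  then show "y \<in> S"
  proof (induct rule: rtrancl_on_induct)
    case (step u v)
    then have "v \<in> nbrs G u" by (auto simp: symcl_def nbrs_def intro: arcs_symmetric)
    then show ?case using closed step by blast
  qed (rule x)
qed

text \<open>
  Reachability inside \<open>G - K\<close> cannot leave \<open>A\<close>, so \<open>a\<close> and \<open>b\<close> lie in different components of
  \<open>G - K\<close>, whereas \<open>G\<close> has a single component.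
\<close>

lemma clique_cutsetI:
  assumes conn: "Digraph_Component.connected (with_proj G)"
    and K: "clique G K"
    and A: "a \<in> A" "A \<subseteq> pverts G - K" "\<And>u. u \<in> A \<Longrightarrow> nbrs G u \<subseteq> A \<union> K"
    and b: "b \<in> pverts G" "b \<notin> K" "b \<notin> A"
  shows "clique_cutset G K"
proof -
  define D where "D = with_proj G \<restriction> (pverts G - K)"
  interpret D: wf_digraph D unfolding D_def by (rule wellformed_induce_subgraph)
  interpret D: fin_digraph D
    by unfold_locales (auto simp: D_def pair_finite_verts pair_finite_arcs)
  have "strongly_connected (with_proj G)"
    using symmetric_connected_imp_strongly_connected[OF pair_sym_arcs conn] .
  then have one: "card (pre_digraph.sccs (with_proj G)) = 1"
    using strongly_connected_eq_iff by simp
  have stay: "v \<in> A" if "a \<rightarrow>\<^sup>*\<^bsub>D\<^esub> v" for v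
    using that
  proof (induct rule: D.reachable_induct)
    case (step x y)
    then have "y \<in> nbrs G x" "y \<notin> K" by (auto simp: D_def nbrs_def arcs_ends_conv)
    then show ?case using A(3) step by blast
  qed (rule A(1))
  have in_D: "a \<in> verts D" "b \<in> verts D" using A b by (auto simp: D_def)
  have "a \<in> D.scc_of a" "a \<notin> D.scc_of b"
    using in_D stay b by (auto simp: D.scc_of_def)
  then have "D.scc_of a \<noteq> D.scc_of b" by blast
  then have "card {D.scc_of a, D.scc_of b} = 2" by simp
  moreover have "card {D.scc_of a, D.scc_of b} \<le> card D.sccs_verts"
    using in_D by (intro card_mono D.finite_sccs_verts) (auto intro: D.scc_of_in_sccs_verts)
  ultimately have "card D.sccs > 1" using D.card_sccs_verts by simp
  then show ?thesis unfolding clique_cutset_def using K one by (simp add: D_def)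
qed


lemma nbrs_eq_pairI: "card (nbrs G v) \<le> 2 \<Longrightarrow> x \<in> nbrs G v \<Longrightarrow> y \<in> nbrs G v \<Longrightarrow> x \<noteq> y \<Longrightarrow> nbrs G v = {x, y}"
  by (rule card_seteq[symmetric]) (auto simp: finite_nbrs)

lemma nbrs_eq_tripleI:
  "card (nbrs G v) \<le> 3 \<Longrightarrow> x \<in> nbrs G v \<Longrightarrow> y \<in> nbrs G v \<Longrightarrow> z \<in> nbrs G v \<Longrightarrow>
   x \<noteq> y \<Longrightarrow> x \<noteq> z \<Longrightarrow> y \<noteq> z \<Longrightarrow> nbrs G v = {x, y, z}"
  by (rule card_seteq[symmetric]) (auto simp: finite_nbrs)

text \<open>
  Take a longest path. All neighbours of its first vertex lie on it. The neighbour other than the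
  second vertex must be the last vertex, since an inner vertex already has its two neighbours on the
  path. So the path closes to a cycle, which by 2-regularity contains all neighbours of its vertices
  and by connectedness is the whole graph.
\<close>

lemma two_regular_iso_cycle:
  assumes conn: "Digraph_Component.connected (with_proj G)"
    and deg: "\<And>v. v \<in> pverts G \<Longrightarrow> card (nbrs G v) = 2"
  shows "\<exists>k\<ge>3. digraph_iso (with_proj G) (with_proj (cycle_graph k))"
proof -
  define path where "path xs \<longleftrightarrow> xs \<noteq> [] \<and> distinct xs \<and> set xs \<subseteq> pverts G \<and>
    (\<forall>i. Suc i < length xs \<longrightarrow> xs ! Suc i \<in> nbrs G (xs ! i))" for xs
  have "pverts G \<noteq> {}" using conn by (simp add: connected_conv)
  then obtain v where "v \<in> pverts G" by blast
  then have "path [v]" by (simp add: path_def)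
  moreover have "length xs < Suc (card (pverts G))" if "path xs" for xs
    using that card_mono[OF pair_finite_verts, of "set xs"] by (simp add: path_def distinct_card)
  ultimately obtain xs where xs: "path xs" and longest: "\<And>ys. path ys \<Longrightarrow> length ys \<le> length xs"
    using ex_has_greatest_nat[of path "[v]" length "Suc (card (pverts G))"] by auto
  define n where "n = length xs"
  have n0: "0 < n" and dist: "distinct xs" and sub: "set xs \<subseteq> pverts G"
    and step: "\<And>i. Suc i < n \<Longrightarrow> xs ! Suc i \<in> nbrs G (xs ! i)"
    using xs by (auto simp: path_def n_def)
  have nth_eq: "xs ! i = xs ! j \<longleftrightarrow> i = j" if "i < n" "j < n" for i j
    using that dist by (simp add: n_def nth_eq_iff_index_eq)
  have nth_vert: "xs ! i \<in> pverts G" if "i < n" for i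
    using that sub by (auto simp: n_def)
  have end_nbrs: "nbrs G (xs ! 0) \<subseteq> set xs"
  proof
    fix z assume z: "z \<in> nbrs G (xs ! 0)"
    show "z \<in> set xs"
    proof (rule ccontr)
      assume "z \<notin> set xs"
      moreover have "(z # xs) ! Suc i \<in> nbrs G ((z # xs) ! i)" if "Suc i < length (z # xs)" for i
        using that step z nbrs_sym by (cases i) (auto simp: n_def)
      ultimately have "path (z # xs)"
        using xs z by (auto simp: path_def nbrs_verts)
      then show False using longest[of "z # xs"] by simp
    qed
  qed
  have deg0: "card (nbrs G (xs ! 0)) = 2" using n0 by (intro deg nth_vert)
  have "card (insert (xs ! 0) (nbrs G (xs ! 0))) = 3"
    using deg0 nbrs_irrefl by (simp add: finite_nbrs)
  moreover have "insert (xs ! 0) (nbrs G (xs ! 0)) \<subseteq> set xs"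
    using end_nbrs n0 by (simp add: n_def)
  ultimately have n3: "3 \<le> n"
    using card_mono[of "set xs" "insert (xs ! 0) (nbrs G (xs ! 0))"] dist
    by (simp add: n_def distinct_card)
  have one: "xs ! 1 \<in> nbrs G (xs ! 0)" using step[of 0] n3 by simp
  have "\<exists>z \<in> nbrs G (xs ! 0). z \<noteq> xs ! 1"
  proof (rule ccontr)
    assume "\<not> ?thesis"
    then have "nbrs G (xs ! 0) = {xs ! 1}" using one by blast
    then show False using deg0 by simp
  qed
  then obtain z where z: "z \<in> nbrs G (xs ! 0)" "z \<noteq> xs ! 1" by blast
  then obtain j where j: "j < n" "z = xs ! j" using end_nbrs by (force simp: n_def in_set_conv_nth)
  have "j \<noteq> 0" using z j nbrs_irrefl by metis
  have "j \<noteq> 1" using z j by auto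
  have closing: "j = n - 1"
  proof (rule ccontr)
    assume "j \<noteq> n - 1"
    then have j': "Suc j < n" using j by simp
    obtain i where i: "j = Suc i" using \<open>j \<noteq> 0\<close> by (cases j) auto
    have "nbrs G (xs ! j) = {xs ! i, xs ! Suc j}"
      using step[of i] step[of j] j' i nbrs_sym nth_eq[of i "Suc j"]
      by (intro nbrs_eq_pairI) (auto simp: deg nth_vert)
    moreover have "xs ! 0 \<in> nbrs G (xs ! j)" using z j nbrs_sym by blast
    ultimately have "xs ! 0 = xs ! i \<or> xs ! 0 = xs ! Suc j" by blast
    then show False using nth_eq[of 0 i] nth_eq[of 0 "Suc j"] i j' \<open>j \<noteq> 1\<close> by auto
  qed
  \<comment> \<open>The path is indexed from 0, the vertices of the cycle graph from 1.\<close>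
  define f where "f i = xs ! (i - 1)" for i
  have f_eq: "f i = f j \<longleftrightarrow> i = j" if "i \<in> {1..n}" "j \<in> {1..n}" for i j
    using that nth_eq[of "i - 1" "j - 1"] by (cases i; cases j) (auto simp: f_def)
  have next_f: "f (Suc i) \<in> nbrs G (f i)" "f i \<in> nbrs G (f (Suc i))" if "1 \<le> i" "i < n" for i
    using that step[of "i - 1"] nbrs_sym by (auto simp: f_def)
  have wrap: "f n \<in> nbrs G (f 1)" "f 1 \<in> nbrs G (f n)"
    using z j closing nbrs_sym by (auto simp: f_def)
  have image: "set xs = f ` {1..n}"
  proof -
    have "xs ! i \<in> f ` {1..n}" if "i < n" for i
      using that by (intro rev_image_eqI[of "Suc i"]) (auto simp: f_def)
    moreover have "f i \<in> set xs" if "i \<in> {1..n}" for i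
      using that by (auto simp: f_def n_def)
    ultimately show ?thesis by (auto simp: n_def in_set_conv_nth)
  qed
  have nbrs_f: "nbrs G (f i) = f ` nbrs (cycle_graph n) i" if i: "i \<in> {1..n}" for i
  proof -
    define p s where "p = (if i = 1 then n else i - 1)" and "s = (if i = n then 1 else Suc i)"
    have ps: "p \<in> {1..n}" "s \<in> {1..n}" "p \<noteq> s" using i n3 by (auto simp: p_def s_def)
    have "nbrs (cycle_graph n) i = {p, s}"
      using i n3 unfolding nbrs_def cycle_graph_arc_iff p_def s_def by auto
    moreover have "f i \<in> pverts G" using i sub image by blast
    then have "nbrs G (f i) = {f p, f s}"
      using i ps wrap next_f[of i] next_f[of "i - 1"] f_eq
      by (intro nbrs_eq_pairI) (auto simp: deg p_def s_def split: if_splits)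
    ultimately show ?thesis by simp
  qed
  have "pverts G \<subseteq> set xs"
  proof (rule connected_closed_set[OF conn])
    show "xs ! 0 \<in> set xs" "xs ! 0 \<in> pverts G" using n0 nth_vert by (auto simp: n_def)
    fix u assume "u \<in> set xs"
    then obtain i where i: "i \<in> {1..n}" "u = f i" using image by blast
    have "nbrs (cycle_graph n) i \<subseteq> {1..n}" using n3 by (auto simp: nbrs_def cycle_graph_arc_iff)
    then show "nbrs G u \<subseteq> set xs" using nbrs_f[OF i(1)] i image by auto
  qed
  then have "pverts G = f ` {1..n}" using sub image by simp
  then have "digraph_iso (with_proj G) (with_proj (cycle_graph n))"
    using n3 nbrs_f f_eq
    by (intro digraph_iso_nbrsI[where f = f] pair_wf_cycle_graph pair_wf_digraph_axioms)
       (auto simp: cycle_graph_verts inj_on_def)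
  then show ?thesis using n3 by blast
qed

end

section \<open>Degrees and distances\<close>

text \<open>An atom is a connected graph without clique cutsets.\<close>

locale fork_free_atom = pair_graph +
  assumes conn: "Digraph_Component.connected (with_proj G)"
    and free: "H_free {fork_plus, cycle_graph 4, cycle_graph 3} G"
    and no_cutset: "\<And>K. \<not> clique_cutset G K"
    and not_complete: "\<And>n. \<not> complete_digraph n (with_proj G)"
begin

lemma arc_nbrs: "(u, v) \<in> parcs G \<longleftrightarrow> v \<in> nbrs G u"
  by (simp add: nbrs_def)

lemma no_triangle:
  assumes "y \<in> nbrs G x" "z \<in> nbrs G x" "z \<in> nbrs G y"
  shows False
proof (rule H_free_no_induced_copy[OF pair_wf_digraph_axioms, where H = "cycle_graph 3"])
  let ?f = "\<lambda>i::nat. if i = 1 then x else if i = 2 then y else z"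
  have *: "pverts (cycle_graph 3) = {1, 2, 3}" by (auto simp: cycle_graph_verts)
  have ne: "x \<noteq> y" "x \<noteq> z" "y \<noteq> z" using assms nbrs_irrefl by auto
  have adj: "x \<in> nbrs G y" "x \<in> nbrs G z" "y \<in> nbrs G z" using assms nbrs_sym by auto
  show "inj_on ?f (pverts (cycle_graph 3))" using ne unfolding * by (simp add: inj_on_def)
  show "?f ` pverts (cycle_graph 3) \<subseteq> pverts G" using assms adj nbrs_verts unfolding * by auto
  show "(?f u, ?f v) \<in> parcs G \<longleftrightarrow> (u, v) \<in> parcs (cycle_graph 3)"
    if "u \<in> pverts (cycle_graph 3)" "v \<in> pverts (cycle_graph 3)" for u v
    using that assms adj nbrs_irrefl unfolding * by (auto simp: cycle_graph_arc_iff arc_nbrs)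
qed (use free pair_wf_cycle_graph in auto)

text \<open>
  Without triangles a 4-cycle has no chord. It is described by two common neighbours \<open>b, d\<close> of two
  vertices \<open>a, c\<close>, the form in which it arises below.
\<close>

lemma no_square:
  assumes "b \<in> nbrs G a" "d \<in> nbrs G a" "b \<in> nbrs G c" "d \<in> nbrs G c" "a \<noteq> c" "b \<noteq> d"
  shows False
proof (rule H_free_no_induced_copy[OF pair_wf_digraph_axioms, where H = "cycle_graph 4"])
  let ?f = "\<lambda>i::nat. if i = 1 then a else if i = 2 then b else if i = 3 then c else d"
  have *: "pverts (cycle_graph 4) = {1, 2, 3, 4}" by (auto simp: cycle_graph_verts)
  have adj: "a \<in> nbrs G b" "a \<in> nbrs G d" "c \<in> nbrs G b" "c \<in> nbrs G d" using assms nbrs_sym by auto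
  have ne: "a \<noteq> b" "a \<noteq> d" "b \<noteq> c" "c \<noteq> d" using assms nbrs_irrefl by auto
  have non: "a \<notin> nbrs G c" "c \<notin> nbrs G a" "b \<notin> nbrs G d" "d \<notin> nbrs G b"
    using assms adj no_triangle by blast+
  show "inj_on ?f (pverts (cycle_graph 4))"
    using ne assms unfolding * by (simp add: inj_on_def)
  show "?f ` pverts (cycle_graph 4) \<subseteq> pverts G" using assms adj nbrs_verts unfolding * by auto
  show "(?f u, ?f v) \<in> parcs G \<longleftrightarrow> (u, v) \<in> parcs (cycle_graph 4)"
    if "u \<in> pverts (cycle_graph 4)" "v \<in> pverts (cycle_graph 4)" for u v
    using that assms adj non nbrs_irrefl unfolding * by (auto simp: cycle_graph_arc_iff arc_nbrs)
qed (use free pair_wf_cycle_graph in auto)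

text \<open>
  The vertices \<open>x, y, z, p, q, r\<close> carry a fork\<open>\<^sup>+\<close> with centre \<open>x\<close>, leaves \<open>y, z\<close> and long arm
  \<open>p, q, r\<close>. Every chord other than \<open>r y\<close> and \<open>r z\<close> would create a triangle or a 4-cycle.
\<close>

lemma path_end_adjacent:
  assumes x: "p \<in> nbrs G x" "y \<in> nbrs G x" "z \<in> nbrs G x" and ne: "p \<noteq> y" "p \<noteq> z" "y \<noteq> z"
    and path: "q \<in> nbrs G p" "q \<noteq> x" "r \<in> nbrs G q" "r \<noteq> p"
  shows "r \<in> nbrs G y \<or> r \<in> nbrs G z"
proof (rule ccontr)
  assume "\<not> ?thesis"
  then have r: "r \<notin> nbrs G y" "r \<notin> nbrs G z" "y \<notin> nbrs G r" "z \<notin> nbrs G r"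
    using nbrs_sym by auto
  have adj: "x \<in> nbrs G p" "x \<in> nbrs G y" "x \<in> nbrs G z" "p \<in> nbrs G q" "q \<in> nbrs G r"
    using x path nbrs_sym by auto
  have non: "y \<notin> nbrs G z" "z \<notin> nbrs G y" "y \<notin> nbrs G p" "p \<notin> nbrs G y" "z \<notin> nbrs G p" "p \<notin> nbrs G z"
    "x \<notin> nbrs G q" "q \<notin> nbrs G x" "r \<notin> nbrs G p" "p \<notin> nbrs G r"
    using x path adj no_triangle by blast+
  have "r \<noteq> x" using non path by auto
  have far: "y \<notin> nbrs G q" "z \<notin> nbrs G q" "r \<notin> nbrs G x"
    using no_square[of p x y q] no_square[of p x z q] no_square[of p x r q] x path adj ne \<open>r \<noteq> x\<close>
    by auto
  then have far': "q \<notin> nbrs G y" "q \<notin> nbrs G z" "x \<notin> nbrs G r" using nbrs_sym by auto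
  have ne': "x \<noteq> y" "x \<noteq> z" "x \<noteq> p" "x \<noteq> q" "x \<noteq> r" "y \<noteq> q" "y \<noteq> r" "z \<noteq> q" "z \<noteq> r" "p \<noteq> q" "q \<noteq> r"
    using x path adj non far \<open>r \<noteq> x\<close> nbrs_irrefl by auto
  let ?f = "\<lambda>i::nat. if i = 0 then x else if i = 1 then y else if i = 2 then z
    else if i = 3 then r else if i = 4 then p else q"
  show False
  proof (rule H_free_no_induced_copy[OF pair_wf_digraph_axioms, where H = fork_plus])
    show "inj_on ?f (pverts fork_plus)"
      using ne ne' path(4) by (simp add: inj_on_def fork_plus_verts)
    show "?f ` pverts fork_plus \<subseteq> pverts G"
      using x path adj nbrs_verts by (auto simp: fork_plus_verts)
    show "(?f u, ?f v) \<in> parcs G \<longleftrightarrow> (u, v) \<in> parcs fork_plus"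
      if "u \<in> pverts fork_plus" "v \<in> pverts fork_plus" for u v
      using that x path adj non far far' r nbrs_irrefl
      unfolding fork_plus_verts fork_plus_arcs arc_nbrs by (elim insertE emptyE) simp_all
  qed (use free pair_wf_fork_plus in auto)
qed

lemma no_cut:
  assumes "clique G K" "a \<in> A" "A \<subseteq> pverts G - K" "\<And>u. u \<in> A \<Longrightarrow> nbrs G u \<subseteq> A \<union> K"
  shows "pverts G \<subseteq> A \<union> K"
  using clique_cutsetI[OF conn assms] no_cutset by blast

text \<open>
  If \<open>v\<close> has at most one neighbour, then \<open>nbrs G v\<close> is a clique separating \<open>v\<close> from all remaining
  vertices. So there are none, and the graph is \<open>K\<^sub>1\<close> or \<open>K\<^sub>2\<close>.
\<close>

lemma degree_ge_2:
  assumes v: "v \<in> pverts G"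
  shows "2 \<le> card (nbrs G v)"
proof (rule ccontr)
  assume "\<not> ?thesis"
  then have "card (nbrs G v) \<le> Suc 0" by simp
  then have single: "\<And>x y. x \<in> nbrs G v \<Longrightarrow> y \<in> nbrs G v \<Longrightarrow> x = y"
    using finite_nbrs by (meson card_le_Suc0_iff_eq)
  have "clique G (nbrs G v)" unfolding clique_def using single nbrs_verts by blast
  then have "pverts G \<subseteq> {v} \<union> nbrs G v"
    using v nbrs_irrefl by (intro no_cut[where a = v]) auto
  then have V: "pverts G = insert v (nbrs G v)" using v nbrs_verts by auto
  have "parcs G = {(x, y). (x, y) \<in> pverts G \<times> pverts G \<and> x \<noteq> y}"
  proof (intro set_eqI iffI; clarify)
    fix x y assume "(x, y) \<in> parcs G"
    then show "(x, y) \<in> pverts G \<times> pverts G \<and> x \<noteq> y" using no_loops' wellformed' by auto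
  next
    fix x y assume "x \<in> pverts G" "y \<in> pverts G" "x \<noteq> y"
    then have "(x = v \<and> y \<in> nbrs G v) \<or> (y = v \<and> x \<in> nbrs G v)" using V single by auto
    then show "(x, y) \<in> parcs G" using nbrs_sym arc_nbrs by blast
  qed
  then have "complete_digraph (card (pverts G)) (with_proj G)"
    unfolding complete_digraph_pair_def using pair_finite_verts by simp
  then show False using not_complete by blast
qed

lemma other_nbr: "v \<in> pverts G \<Longrightarrow> \<exists>w \<in> nbrs G v. w \<noteq> u"
  using degree_ge_2[of v] card_mono[of "{u}" "nbrs G v"] by fastforce

text \<open>
  Start a path \<open>v, p, q, r\<close> at a vertex \<open>v\<close> with further neighbours \<open>x, y, z\<close>. Of any two of them
  exactly one is adjacent to \<open>r\<close>, which is impossible for three vertices.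
\<close>

lemma degree_le_3:
  assumes v: "v \<in> pverts G"
  shows "card (nbrs G v) \<le> 3"
proof (rule ccontr)
  assume "\<not> ?thesis"
  then have "4 \<le> card (nbrs G v)" by simp
  then obtain T where T: "T \<subseteq> nbrs G v" "card T = 4" by (meson obtain_subset_with_card_n)
  then obtain p x y z where d: "distinct [p, x, y, z]" "T = {p, x, y, z}"
    by (auto simp: card_Suc_eq numeral_eq_Suc)
  have in_N: "p \<in> nbrs G v" "x \<in> nbrs G v" "y \<in> nbrs G v" "z \<in> nbrs G v" using T d by auto
  obtain q where q: "q \<in> nbrs G p" "q \<noteq> v" using other_nbr in_N nbrs_verts by blast
  obtain r where r: "r \<in> nbrs G q" "r \<noteq> p" using other_nbr q nbrs_verts by blast
  have "r \<noteq> v" using no_triangle[of p v q] in_N q r nbrs_sym by blast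
  have pairs: "r \<in> nbrs G s \<or> r \<in> nbrs G t" if "s \<in> {x, y, z}" "t \<in> {x, y, z}" "s \<noteq> t" for s t
    using path_end_adjacent[of p v s t q r] that in_N q r d by auto
  have one: "\<not> (r \<in> nbrs G s \<and> r \<in> nbrs G t)" if "s \<in> {x, y, z}" "t \<in> {x, y, z}" "s \<noteq> t" for s t
    using no_square[of s v t r] that in_N \<open>r \<noteq> v\<close> nbrs_sym by blast
  show False using pairs[of x y] pairs[of x z] pairs[of y z] one[of x y] one[of x z] one[of y z] d
    by auto
qed

text \<open>
  The vertices at distance at most 2 from \<open>c\<close> are closed under taking neighbours: a step \<open>u, r\<close> out
  of the second layer completes a path \<open>c, p, u, r\<close>, and then \<open>r\<close> is adjacent to another neighbour
  of \<open>c\<close>.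
\<close>

lemma within_distance_2:
  assumes c: "card (nbrs G c) = 3" and y: "y \<in> pverts G"
  shows "y = c \<or> y \<in> nbrs G c \<or> (\<exists>p \<in> nbrs G c. y \<in> nbrs G p)"
proof -
  let ?S = "{c} \<union> nbrs G c \<union> (\<Union>p \<in> nbrs G c. nbrs G p)"
  have "nbrs G c \<noteq> {}" using c by auto
  then have cV: "c \<in> pverts G" using nbrs_sym nbrs_verts by blast
  have "pverts G \<subseteq> ?S"
  proof (rule connected_closed_set[OF conn _ cV])
    fix u assume u: "u \<in> ?S"
    show "nbrs G u \<subseteq> ?S"
    proof
      fix r assume r: "r \<in> nbrs G u"
      show "r \<in> ?S"
      proof (cases "u = c \<or> u \<in> nbrs G c")
        case True
        then show ?thesis using r by auto
      next
        case False
        then obtain p where p: "p \<in> nbrs G c" "u \<in> nbrs G p" using u by auto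
        have "card (nbrs G c - {p}) = 2" using c p by simp
        then obtain y z where "nbrs G c - {p} = {y, z}" "y \<noteq> z" by (auto simp: card_2_iff)
        then have yz: "y \<in> nbrs G c" "z \<in> nbrs G c" "p \<noteq> y" "p \<noteq> z" "y \<noteq> z" by auto
        have "r = p \<or> r \<in> nbrs G y \<or> r \<in> nbrs G z"
          using path_end_adjacent[of p c y z u r] p yz r False by blast
        then show ?thesis using p yz by blast
      qed
    qed
  qed simp
  then show ?thesis using y by auto
qed


section \<open>The graph around a vertex of degree three\<close>

lemma verts_eq_two_layers:
  assumes "card (nbrs G c) = 3"
  shows "pverts G = insert c (nbrs G c \<union> (\<Union>p \<in> nbrs G c. nbrs G p))"
proof -
  have "nbrs G c \<noteq> {}" using assms by auto
  then have "c \<in> pverts G" using nbrs_sym nbrs_verts by blast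
  then show ?thesis using within_distance_2[OF assms] nbrs_verts by blast
qed

lemma layers_disjoint: "p \<in> nbrs G c \<Longrightarrow> nbrs G c \<inter> nbrs G p = {}"
  using no_triangle by blast

lemma branches_disjoint:
  assumes "p \<in> nbrs G c" "p' \<in> nbrs G c" "p \<noteq> p'"
  shows "nbrs G p \<inter> nbrs G p' = {c}"
proof -
  have "q = c" if "q \<in> nbrs G p" "q \<in> nbrs G p'" for q
    using no_square[of p c p' q] that assms nbrs_sym by blast
  moreover have "c \<in> nbrs G p" "c \<in> nbrs G p'" using assms nbrs_sym by auto
  ultimately show ?thesis by blast
qed

text \<open>
  The distance bound is applied to \<open>p'\<close> here: the vertex \<open>q\<close> hanging below \<open>p\<close> is neither \<open>p'\<close> nor a
  neighbour of \<open>p'\<close>, so it is adjacent to one, and that one is not \<open>c\<close>.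
\<close>

lemma partner:
  assumes "p \<in> nbrs G c" "p' \<in> nbrs G c" "p \<noteq> p'" and p': "card (nbrs G p') = 3"
    and q: "q \<in> nbrs G p" "q \<noteq> c"
  shows "\<exists>q' \<in> nbrs G p'. q' \<noteq> c \<and> q' \<in> nbrs G q \<and> q \<in> nbrs G q'"
proof -
  have "q \<notin> nbrs G c" "q \<notin> nbrs G p'"
    using layers_disjoint branches_disjoint assms by blast+
  moreover have "q \<noteq> p'" using calculation assms by blast
  ultimately obtain q' where "q' \<in> nbrs G p'" "q \<in> nbrs G q'"
    using within_distance_2[OF p'] q nbrs_verts by blast
  moreover have "q' \<noteq> c" using calculation \<open>q \<notin> nbrs G c\<close> by blast
  ultimately show ?thesis using nbrs_sym by blast
qed

text \<open>
  Together with \<open>partner\<close> this makes the edges between the vertices below two neighbours of \<open>c\<close> a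
  matching.
\<close>

lemma partner_unique:
  assumes "q \<in> nbrs G p" "q' \<in> nbrs G p" "q \<noteq> q'" "r \<noteq> p" "r \<in> nbrs G q"
  shows "r \<notin> nbrs G q'"
  using no_square[of q p q' r] assms nbrs_sym by blast

lemma third_nbr:
  assumes "card (nbrs G p) = 3" "c \<in> nbrs G p" "a \<in> nbrs G p" "a \<noteq> c"
  obtains a' where "nbrs G p = {c, a, a'}" "a' \<noteq> a" "a' \<noteq> c"
proof -
  have "card (nbrs G p - {c, a}) = 1" using assms by (simp add: card_Diff_subset)
  then obtain a' where "nbrs G p - {c, a} = {a'}" by (auto simp: card_1_singleton_iff)
  then show ?thesis using assms that[of a'] by blast
qed

lemma second_nbr:
  assumes "card (nbrs G p) = 2" "c \<in> nbrs G p"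
  obtains a where "nbrs G p = {c, a}" "a \<noteq> c"
proof -
  have "card (nbrs G p - {c}) = 1" using assms by simp
  then obtain a where "nbrs G p - {c} = {a}" by (auto simp: card_1_singleton_iff)
  then show ?thesis using assms that[of a] by blast
qed

text \<open>
  In this lemma and its companions for \<open>F4\<close>, \<open>F3\<close> and \<open>F2'\<close>, the vertices below the neighbours
  \<open>p, q, r\<close> of \<open>c\<close> are called \<open>a, a'\<close>, \<open>b, b'\<close> and \<open>d, d'\<close>, without the second name for a
  neighbour of degree 2.

  If all neighbours of \<open>c\<close> have degree 3, the matchings between the three groups are perfect. With
  \<open>a b\<close> and \<open>b d\<close> chosen as edges by naming, the triangle \<open>a b d\<close> is excluded, so the matched
  vertices form the 6-cycle \<open>a, b, d, a', b', d'\<close>.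
\<close>

lemma iso_F5:
  assumes c: "card (nbrs G c) = 3" "p \<in> nbrs G c" "q \<in> nbrs G c" "r \<in> nbrs G c"
    "p \<noteq> q" "p \<noteq> r" "q \<noteq> r"
    and deg: "card (nbrs G p) = 3" "card (nbrs G q) = 3" "card (nbrs G r) = 3"
  shows "digraph_iso (with_proj G) (with_proj F5)"
proof -
  have Nc: "nbrs G c = {p, q, r}" using c by (intro nbrs_eq_tripleI) auto
  have cN: "c \<in> nbrs G p" "c \<in> nbrs G q" "c \<in> nbrs G r" using c nbrs_sym by auto
  obtain a where a: "a \<in> nbrs G p" "a \<noteq> c" using other_nbr c nbrs_verts by blast
  obtain a' where Np: "nbrs G p = {c, a, a'}" "a' \<noteq> a" "a' \<noteq> c"
    using third_nbr deg(1) cN(1) a by blast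
  obtain b where b: "b \<in> nbrs G q" "b \<noteq> c" "b \<in> nbrs G a" "a \<in> nbrs G b"
    using partner[of p c q a] c deg a by blast
  obtain b' where Nq: "nbrs G q = {c, b, b'}" "b' \<noteq> b" "b' \<noteq> c"
    using third_nbr deg(2) cN(2) b by blast
  obtain d where d: "d \<in> nbrs G r" "d \<noteq> c" "d \<in> nbrs G b" "b \<in> nbrs G d"
    using partner[of q c r b] c deg b by blast
  obtain d' where Nr: "nbrs G r = {c, d, d'}" "d' \<noteq> d" "d' \<noteq> c"
    using third_nbr deg(3) cN(3) d by blast
  have dist: "distinct [c, p, q, r, a, a', b, b', d, d']"
    using layers_disjoint[of p c] layers_disjoint[of q c] layers_disjoint[of r c]
      branches_disjoint[of p c q] branches_disjoint[of p c r] branches_disjoint[of q c r]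
      nbrs_irrefl[of c] c a b d Np Nq Nr unfolding Nc by auto
  have "b' \<in> nbrs G a'"
    using partner[of p c q a'] partner_unique[of a p a' b] c deg Np Nq b dist by auto
  moreover have "d' \<in> nbrs G b'"
    using partner[of q c r b'] partner_unique[of b q b' d] c deg Nq Nr d dist by auto
  moreover have "d' \<in> nbrs G a"
    using partner[of p c r a] no_triangle[of b a d] c deg Np Nr b d dist by auto
  moreover from this have "d \<in> nbrs G a'"
    using partner[of p c r a'] partner_unique[of a p a' d'] c deg Np Nr dist by auto
  ultimately have adj: "b' \<in> nbrs G a'" "a' \<in> nbrs G b'" "d' \<in> nbrs G b'" "b' \<in> nbrs G d'"
    "d' \<in> nbrs G a" "a \<in> nbrs G d'" "d \<in> nbrs G a'" "a' \<in> nbrs G d"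
    using nbrs_sym by auto
  have V: "pverts G = {c, p, q, r, a, a', b, b', d, d'}"
    unfolding verts_eq_two_layers[OF c(1)] by (auto simp: Nc Np Nq Nr)
  have up: "p \<in> nbrs G a" "p \<in> nbrs G a'" "q \<in> nbrs G b" "q \<in> nbrs G b'" "r \<in> nbrs G d" "r \<in> nbrs G d'"
    using Np Nq Nr nbrs_sym by auto
  have N: "nbrs G a = {p, b, d'}" "nbrs G a' = {p, b', d}" "nbrs G b = {q, a, d}"
    "nbrs G b' = {q, a', d'}" "nbrs G d = {r, b, a'}" "nbrs G d' = {r, b', a}"
    by (rule nbrs_eq_tripleI; use up adj b d dist degree_le_3 nbrs_verts in auto)+
  let ?f = "\<lambda>i::nat. if i = 1 then c else if i = 2 then p else if i = 5 then q else if i = 11 then r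
    else if i = 3 then a else if i = 12 then a' else if i = 4 then b else if i = 15 then b'
    else if i = 14 then d else d'"
  show ?thesis
  proof (rule digraph_iso_tableI[where f = ?f and us = "[1, 2, 5, 11, 3, 12, 4, 15, 14, 13]"])
    show "pverts F5 = set [1, 2, 5, 11, 3, 12, 4, 15, 14, 13]" by (auto simp: F_simps)
    show "distinct (map ?f [1, 2, 5, 11, 3, 12, 4, 15, 14, 13])" using dist by simp
    show "pverts G = set (map ?f [1, 2, 5, 11, 3, 12, 4, 15, 14, 13])" using V by simp
    show "list_all (\<lambda>u. nbrs G (?f u) = ?f ` nbrs F5 u) [1, 2, 5, 11, 3, 12, 4, 15, 14, 13]"
      by (simp add: F_simps Nc Np Nq Nr N insert_commute)
  qed (rule pair_wf_digraph_axioms pair_wf_F)+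
qed

text \<open>
  The single vertex \<open>d\<close> below \<open>r\<close> has partners \<open>a\<close> and \<open>b'\<close>, which are not adjacent, as they would
  form a triangle with \<open>d\<close>. So the perfect matching between the other two groups consists of \<open>a b\<close>
  and \<open>a' b'\<close>. Every other possible edge at \<open>a'\<close> or \<open>b\<close> closes a 4-cycle or exceeds degree 3.
\<close>

lemma iso_F4:
  assumes c: "card (nbrs G c) = 3" "p \<in> nbrs G c" "q \<in> nbrs G c" "r \<in> nbrs G c"
    "p \<noteq> q" "p \<noteq> r" "q \<noteq> r"
    and deg: "card (nbrs G p) = 3" "card (nbrs G q) = 3" "card (nbrs G r) = 2"
  shows "digraph_iso (with_proj G) (with_proj F4)"
proof -
  have Nc: "nbrs G c = {p, q, r}" using c by (intro nbrs_eq_tripleI) auto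
  have cN: "c \<in> nbrs G p" "c \<in> nbrs G q" "c \<in> nbrs G r" using c nbrs_sym by auto
  obtain d where Nr: "nbrs G r = {c, d}" "d \<noteq> c" using second_nbr deg(3) cN(3) by blast
  obtain a where a: "a \<in> nbrs G p" "a \<noteq> c" "a \<in> nbrs G d" "d \<in> nbrs G a"
    using partner[of r c p d] c deg Nr by blast
  obtain a' where Np: "nbrs G p = {c, a, a'}" "a' \<noteq> a" "a' \<noteq> c"
    using third_nbr deg(1) cN(1) a by blast
  obtain b' where b': "b' \<in> nbrs G q" "b' \<noteq> c" "b' \<in> nbrs G d" "d \<in> nbrs G b'"
    using partner[of r c q d] c deg Nr by blast
  obtain b where Nq: "nbrs G q = {c, b', b}" "b \<noteq> b'" "b \<noteq> c"
    using third_nbr deg(2) cN(2) b' by blast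
  have dist: "distinct [c, p, q, r, a, a', b, b', d]"
    using layers_disjoint[of p c] layers_disjoint[of q c] layers_disjoint[of r c]
      branches_disjoint[of p c q] branches_disjoint[of p c r] branches_disjoint[of q c r]
      nbrs_irrefl[of c] c a b' Np Nq Nr unfolding Nc by auto
  have ab: "b \<in> nbrs G a"
    using partner[of p c q a] no_triangle[of d a b'] c deg Np Nq a b' dist by auto
  then have "b' \<in> nbrs G a'"
    using partner[of p c q a'] partner_unique[of a p a' b] c deg Np Nq dist by auto
  with ab have adj: "b \<in> nbrs G a" "a \<in> nbrs G b" "b' \<in> nbrs G a'" "a' \<in> nbrs G b'"
    using nbrs_sym by auto
  have up: "p \<in> nbrs G a" "p \<in> nbrs G a'" "q \<in> nbrs G b" "q \<in> nbrs G b'" "r \<in> nbrs G d"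
    using Np Nq Nr nbrs_sym by auto
  have N3: "nbrs G a = {p, b, d}" "nbrs G b' = {q, a', d}" "nbrs G d = {r, a, b'}"
    by (rule nbrs_eq_tripleI; use up adj a b' dist degree_le_3 nbrs_verts in auto)+
  have V: "pverts G = {c, p, q, r, a, a', b, b', d}"
    unfolding verts_eq_two_layers[OF c(1)] by (auto simp: Nc Np Nq Nr)
  have "b \<notin> nbrs G a'" using partner_unique[of a p a' b] Np adj dist by auto
  then have non: "b \<notin> nbrs G a'" "a' \<notin> nbrs G b" using nbrs_sym by auto
  have "x \<in> {p, b'}" if "x \<in> nbrs G a'" for x
  proof -
    have "a' \<in> nbrs G x" "x \<in> pverts G" using that nbrs_sym nbrs_verts by auto
    then show ?thesis using non nbrs_irrefl[of a'] dist unfolding V by (auto simp: Nc Np Nq Nr N3)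
  qed
  moreover have "x \<in> {q, a}" if "x \<in> nbrs G b" for x
  proof -
    have "b \<in> nbrs G x" "x \<in> pverts G" using that nbrs_sym nbrs_verts by auto
    then show ?thesis using non nbrs_irrefl[of b] dist unfolding V by (auto simp: Nc Np Nq Nr N3)
  qed
  ultimately have N2: "nbrs G a' = {p, b'}" "nbrs G b = {q, a}" using up adj by blast+
  let ?f = "\<lambda>i::nat. if i = 1 then c else if i = 5 then p else if i = 11 then q else if i = 2 then r
    else if i = 4 then a else if i = 15 then a' else if i = 14 then b else if i = 13 then b' else d"
  show ?thesis
  proof (rule digraph_iso_tableI[where f = ?f and us = "[1, 5, 11, 2, 4, 15, 14, 13, 3]"])
    show "pverts F4 = set [1, 5, 11, 2, 4, 15, 14, 13, 3]" by (auto simp: F_simps)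
    show "distinct (map ?f [1, 5, 11, 2, 4, 15, 14, 13, 3])" using dist by simp
    show "pverts G = set (map ?f [1, 5, 11, 2, 4, 15, 14, 13, 3])" using V by simp
    show "list_all (\<lambda>u. nbrs G (?f u) = ?f ` nbrs F4 u) [1, 5, 11, 2, 4, 15, 14, 13, 3]"
      by (simp add: F_simps Nc Np Nq Nr N2 N3 insert_commute)
  qed (rule pair_wf_digraph_axioms pair_wf_F)+
qed

text \<open>
  The partner \<open>a\<close> of \<open>b\<close> leaves \<open>d\<close> as the only possible second neighbour of \<open>a'\<close>. Only the pair
  \<open>b, d\<close> is still undecided: if it were not an edge, the graph would be two 5-cycles sharing the
  edge \<open>c p\<close>, and \<open>{c, p}\<close> would be a clique cutset.
\<close>

lemma iso_F3:
  assumes c: "card (nbrs G c) = 3" "p \<in> nbrs G c" "q \<in> nbrs G c" "r \<in> nbrs G c"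
    "p \<noteq> q" "p \<noteq> r" "q \<noteq> r"
    and deg: "card (nbrs G p) = 3" "card (nbrs G q) = 2" "card (nbrs G r) = 2"
  shows "digraph_iso (with_proj G) (with_proj F3)"
proof -
  have Nc: "nbrs G c = {p, q, r}" using c by (intro nbrs_eq_tripleI) auto
  have cN: "c \<in> nbrs G p" "c \<in> nbrs G q" "c \<in> nbrs G r" using c nbrs_sym by auto
  obtain b where Nq: "nbrs G q = {c, b}" "b \<noteq> c" using second_nbr deg(2) cN(2) by blast
  obtain d where Nr: "nbrs G r = {c, d}" "d \<noteq> c" using second_nbr deg(3) cN(3) by blast
  obtain a where a: "a \<in> nbrs G p" "a \<noteq> c" "a \<in> nbrs G b" "b \<in> nbrs G a"
    using partner[of q c p b] c deg Nq by blast
  obtain a' where Np: "nbrs G p = {c, a, a'}" "a' \<noteq> a" "a' \<noteq> c"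
    using third_nbr deg(1) cN(1) a by blast
  have dist: "distinct [c, p, q, r, a, a', b, d]"
    using layers_disjoint[of p c] layers_disjoint[of q c] layers_disjoint[of r c]
      branches_disjoint[of p c q] branches_disjoint[of p c r] branches_disjoint[of q c r]
      nbrs_irrefl[of c] c a Np Nq Nr unfolding Nc by auto
  have V: "pverts G = {c, p, q, r, a, a', b, d}"
    unfolding verts_eq_two_layers[OF c(1)] by (auto simp: Nc Np Nq Nr)
  have "a' \<notin> nbrs G a" using no_triangle[of a p a'] Np by auto
  moreover have "b \<notin> nbrs G a'" using partner_unique[of a p a' b] Np a dist by auto
  ultimately have non: "a' \<notin> nbrs G a" "a \<notin> nbrs G a'" "b \<notin> nbrs G a'" "a' \<notin> nbrs G b"
    using nbrs_sym by auto
  have "d \<in> nbrs G a'"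
  proof -
    have "a' \<in> pverts G" using V by simp
    then obtain x where x: "x \<in> nbrs G a'" "x \<noteq> p" using other_nbr by blast
    then have "a' \<in> nbrs G x" "x \<in> pverts G" using nbrs_sym nbrs_verts by auto
    then have "x = d"
      using x non nbrs_irrefl[of a'] dist unfolding V by (auto simp: Nc Np Nq Nr)
    then show ?thesis using x by simp
  qed
  then have adj: "d \<in> nbrs G a'" "a' \<in> nbrs G d" using nbrs_sym by auto
  then have "d \<notin> nbrs G a" using partner_unique[of a' p a d] Np dist by auto
  then have non': "d \<notin> nbrs G a" "a \<notin> nbrs G d" using nbrs_sym by auto
  have up: "p \<in> nbrs G a" "p \<in> nbrs G a'" "q \<in> nbrs G b" "r \<in> nbrs G d"
    using Np Nq Nr nbrs_sym by auto
  have "x \<in> {p, b}" if "x \<in> nbrs G a" for x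
  proof -
    have "a \<in> nbrs G x" "x \<in> pverts G" using that nbrs_sym nbrs_verts by auto
    then show ?thesis using non non' nbrs_irrefl[of a] dist unfolding V by (auto simp: Nc Np Nq Nr)
  qed
  moreover have "x \<in> {p, d}" if "x \<in> nbrs G a'" for x
  proof -
    have "a' \<in> nbrs G x" "x \<in> pverts G" using that nbrs_sym nbrs_verts by auto
    then show ?thesis using non nbrs_irrefl[of a'] dist unfolding V by (auto simp: Nc Np Nq Nr)
  qed
  ultimately have N2: "nbrs G a = {p, b}" "nbrs G a' = {p, d}" using up adj a by blast+
  have bd: "d \<in> nbrs G b"
  proof (rule ccontr)
    assume bd: "d \<notin> nbrs G b"
    have "x \<in> {q, a}" if "x \<in> nbrs G b" for x
    proof -
      have "b \<in> nbrs G x" "x \<in> pverts G" using that nbrs_sym nbrs_verts by auto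
      then show ?thesis using bd that nbrs_irrefl[of b] dist unfolding V by (auto simp: Nc Np Nq Nr N2)
    qed
    then have "pverts G \<subseteq> {a, b, q} \<union> {c, p}"
      using dist cN c by (intro no_cut[where a = a]) (auto simp: clique_def arc_nbrs V Nq N2)
    then show False using V dist by auto
  qed
  then have "b \<in> nbrs G d" using nbrs_sym by auto
  have N3: "nbrs G b = {q, a, d}" "nbrs G d = {r, a', b}"
    by (rule nbrs_eq_tripleI; use up adj a bd \<open>b \<in> nbrs G d\<close> dist degree_le_3 nbrs_verts in auto)+
  let ?f = "\<lambda>i::nat. if i = 1 then c else if i = 11 then p else if i = 2 then q else if i = 5 then r
    else if i = 13 then a else if i = 14 then a' else if i = 3 then b else d"
  show ?thesis
  proof (rule digraph_iso_tableI[where f = ?f and us = "[1, 11, 2, 5, 13, 14, 3, 4]"])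
    show "pverts F3 = set [1, 11, 2, 5, 13, 14, 3, 4]" by (auto simp: F_simps)
    show "distinct (map ?f [1, 11, 2, 5, 13, 14, 3, 4])" using dist by simp
    show "pverts G = set (map ?f [1, 11, 2, 5, 13, 14, 3, 4])" using V by simp
    show "list_all (\<lambda>u. nbrs G (?f u) = ?f ` nbrs F3 u) [1, 11, 2, 5, 13, 14, 3, 4]"
      by (simp add: F_simps Nc Np Nq Nr N2 N3 insert_commute)
  qed (rule pair_wf_digraph_axioms pair_wf_F)+
qed

text \<open>
  Each of \<open>a, b, d\<close> needs a second neighbour, and this must be another one of them. As they do not
  form a triangle, they form a path; \<open>theta\<close> treats the case that \<open>b\<close> is its middle vertex, and the
  other cases are renamings.
\<close>

lemma iso_F2':
  assumes c: "card (nbrs G c) = 3" "p \<in> nbrs G c" "q \<in> nbrs G c" "r \<in> nbrs G c"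
    "p \<noteq> q" "p \<noteq> r" "q \<noteq> r"
    and deg: "card (nbrs G p) = 2" "card (nbrs G q) = 2" "card (nbrs G r) = 2"
  shows "digraph_iso (with_proj G) (with_proj F2')"
proof -
  have theta: "digraph_iso (with_proj G) (with_proj F2')"
    if path: "b \<in> nbrs G a" "d \<in> nbrs G b"
      and N: "nbrs G c = {p, q, r}" "nbrs G p = {c, a}" "nbrs G q = {c, b}" "nbrs G r = {c, d}"
      and dist: "distinct [c, p, q, r, a, b, d]" for p q r a b d
  proof -
    have V: "pverts G = {c, p, q, r, a, b, d}"
      unfolding verts_eq_two_layers[OF c(1)] by (auto simp: N)
    have up: "p \<in> nbrs G a" "q \<in> nbrs G b" "r \<in> nbrs G d" "a \<in> nbrs G b" "b \<in> nbrs G d"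
      using N path nbrs_sym by auto
    have non: "d \<notin> nbrs G a" "a \<notin> nbrs G d"
      using no_triangle[of b a d] no_triangle[of b d a] path up by auto
    have "x \<in> {p, b}" if "x \<in> nbrs G a" for x
    proof -
      have "a \<in> nbrs G x" "x \<in> pverts G" using that nbrs_sym nbrs_verts by auto
      then show ?thesis using non nbrs_irrefl[of a] dist unfolding V by (auto simp: N)
    qed
    moreover have "x \<in> {r, b}" if "x \<in> nbrs G d" for x
    proof -
      have "d \<in> nbrs G x" "x \<in> pverts G" using that nbrs_sym nbrs_verts by auto
      then show ?thesis using non nbrs_irrefl[of d] dist unfolding V by (auto simp: N)
    qed
    ultimately have N2: "nbrs G a = {p, b}" "nbrs G d = {r, b}" using up path by blast+
    have N3: "nbrs G b = {q, a, d}"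
      by (rule nbrs_eq_tripleI) (use up path dist degree_le_3 V in auto)
    let ?f = "\<lambda>i::nat. if i = 1 then c else if i = 5 then p else if i = 2 then q else if i = 11 then r
      else if i = 4 then a else if i = 3 then b else d"
    show ?thesis
    proof (rule digraph_iso_tableI[where f = ?f and us = "[1, 5, 2, 11, 4, 3, 13]"])
      show "pverts F2' = set [1, 5, 2, 11, 4, 3, 13]" by (auto simp: F_simps)
      show "distinct (map ?f [1, 5, 2, 11, 4, 3, 13])" using dist by simp
      show "pverts G = set (map ?f [1, 5, 2, 11, 4, 3, 13])" using V by simp
      show "list_all (\<lambda>u. nbrs G (?f u) = ?f ` nbrs F2' u) [1, 5, 2, 11, 4, 3, 13]"
        by (simp add: F_simps N N2 N3 insert_commute)
    qed (rule pair_wf_digraph_axioms pair_wf_F)+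
  qed
  have Nc: "nbrs G c = {p, q, r}" using c by (intro nbrs_eq_tripleI) auto
  have cN: "c \<in> nbrs G p" "c \<in> nbrs G q" "c \<in> nbrs G r" using c nbrs_sym by auto
  obtain a where Np: "nbrs G p = {c, a}" "a \<noteq> c" using second_nbr deg(1) cN(1) by blast
  obtain b where Nq: "nbrs G q = {c, b}" "b \<noteq> c" using second_nbr deg(2) cN(2) by blast
  obtain d where Nr: "nbrs G r = {c, d}" "d \<noteq> c" using second_nbr deg(3) cN(3) by blast
  have dist: "distinct [c, p, q, r, a, b, d]"
    using layers_disjoint[of p c] layers_disjoint[of q c] layers_disjoint[of r c]
      branches_disjoint[of p c q] branches_disjoint[of p c r] branches_disjoint[of q c r]
      nbrs_irrefl[of c] c Np Nq Nr unfolding Nc by auto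
  have V: "pverts G = {c, p, q, r, a, b, d}"
    unfolding verts_eq_two_layers[OF c(1)] by (auto simp: Nc Np Nq Nr)
  have outer: "\<exists>x \<in> {a, b, d}. x \<in> nbrs G y \<and> y \<in> nbrs G x"
    if y: "y \<in> nbrs G s" "s \<in> {p, q, r}" "y \<noteq> c" for y s
  proof -
    obtain x where x: "x \<in> nbrs G y" "x \<noteq> s" using other_nbr[of y s] y nbrs_verts by blast
    then have "y \<in> nbrs G x" "x \<in> pverts G" using nbrs_sym nbrs_verts by auto
    then show ?thesis using x y dist unfolding V by (auto simp: Nc Np Nq Nr)
  qed
  have "b \<in> nbrs G a \<or> d \<in> nbrs G a" using outer[of a p] Np nbrs_irrefl[of a] by auto
  moreover have "a \<in> nbrs G b \<or> d \<in> nbrs G b" using outer[of b q] Nq nbrs_irrefl[of b] by auto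
  moreover have "a \<in> nbrs G d \<or> b \<in> nbrs G d" using outer[of d r] Nr nbrs_irrefl[of d] by auto
  ultimately consider "b \<in> nbrs G a" "d \<in> nbrs G b" | "a \<in> nbrs G b" "d \<in> nbrs G a"
    | "d \<in> nbrs G a" "b \<in> nbrs G d"
    using nbrs_sym by blast
  then show ?thesis
  proof cases
    case 1
    show ?thesis by (rule theta[of b a d p q r]) (use 1 Nc Np Nq Nr dist in auto)
  next
    case 2
    show ?thesis by (rule theta[of a b d q p r]) (use 2 Nc Np Nq Nr dist in auto)
  next
    case 3
    show ?thesis by (rule theta[of d a b p r q]) (use 3 Nc Np Nq Nr dist in auto)
  qed
qed

lemma degree_3_iso:
  assumes c: "card (nbrs G c) = 3"
  shows "\<exists>F \<in> {F2', F3, F4, F5}. digraph_iso (with_proj G) (with_proj F)"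
proof -
  obtain p q r where N: "nbrs G c = {p, q, r}" "p \<noteq> q" "p \<noteq> r" "q \<noteq> r"
    using c by (auto simp: card_3_iff)
  then have in_N: "p \<in> nbrs G c" "q \<in> nbrs G c" "r \<in> nbrs G c"
    and ne: "p \<noteq> q" "p \<noteq> r" "q \<noteq> r" "q \<noteq> p" "r \<noteq> p" "r \<noteq> q" by auto
  have deg: "card (nbrs G s) = 2 \<or> card (nbrs G s) = 3" if "s \<in> nbrs G c" for s
  proof -
    have "s \<in> pverts G" using that by (rule nbrs_verts)
    then show ?thesis using degree_ge_2 degree_le_3 by fastforce
  qed
  have "digraph_iso (with_proj G) (with_proj F2') \<or> digraph_iso (with_proj G) (with_proj F3) \<or>
      digraph_iso (with_proj G) (with_proj F4) \<or> digraph_iso (with_proj G) (with_proj F5)"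
    using deg[OF in_N(1)] deg[OF in_N(2)] deg[OF in_N(3)] ne
      iso_F2'[OF c in_N] iso_F5[OF c in_N]
      iso_F3[OF c in_N] iso_F3[OF c in_N(2,1,3)] iso_F3[OF c in_N(3,1,2)]
      iso_F4[OF c in_N] iso_F4[OF c in_N(1,3,2)] iso_F4[OF c in_N(2,3,1)]
    by blast
  then show ?thesis by blast
qed

text \<open>Lengths 3 and 4 are excluded, since the graph is an induced subgraph of itself.\<close>

lemma iso_cycle:
  assumes "\<And>v. v \<in> pverts G \<Longrightarrow> card (nbrs G v) \<noteq> 3"
  shows "\<exists>k\<ge>5. digraph_iso (with_proj G) (with_proj (cycle_graph k))"
proof -
  have "card (nbrs G v) = 2" if "v \<in> pverts G" for v
    using assms[OF that] degree_ge_2[OF that] degree_le_3[OF that] by simp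
  then obtain k where k: "k \<ge> 3" "digraph_iso (with_proj G) (with_proj (cycle_graph k))"
    using two_regular_iso_cycle[OF conn] by blast
  have "k \<noteq> 3" "k \<noteq> 4"
    using k(2) free induced_subgraph_refl unfolding H_free_def by auto
  then show ?thesis using k by (intro exI[of _ k]) simp
qed

end

theorem lemma2p3:
  fixes G :: "'a pair_pre_digraph"
  assumes "pair_graph G"
    and "Digraph_Component.connected (with_proj G)"
    and "H_free {fork_plus, cycle_graph 4, cycle_graph 3} G"
    and "\<nexists>K. clique_cutset G K"
    and "\<nexists>n. complete_digraph n (with_proj G)"
  shows "\<exists>F\<in>frakF'. digraph_iso (with_proj G) (with_proj F)"
proof -
  interpret pair_graph G by fact
  interpret fork_free_atom G by unfold_locales (use assms in auto)
  show ?thesis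
  proof (cases "\<exists>c \<in> pverts G. card (nbrs G c) = 3")
    case True
    then show ?thesis using degree_3_iso unfolding frakF'_def by blast
  next
    case False
    then show ?thesis using iso_cycle unfolding frakF'_def by blast
  qed
qed

end
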